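(* Let $x=x(u,v)$ and $y=y(u,v)$ obey the partial differential system $$\frac{\partial}{\partial v}\begin{bmatrix}x\\ y\end{bmatrix}=\frac1f\begin{bmatrix}0&-1\\ 1&0\end{bmatrix}\frac{\partial}{\partial u}\begin{bmatrix}x\\ y\end{bmatrix},\qquad \operatorname{sgn} f=\operatorname{sgn}\kappa,\qquad f^2=1-n^2(x,y)\,(x_u^2+y_u^2),$$ and the initial conditions $$x(u,0)=\alpha(u),\qquad y(u,0)=\beta(u)\qquad \text{for } a\le u\le b.$$ Assume $x(u,v)$ and $y(u,v)$ depend smoothly upon $u$ for every nonnegative, sufficiently small $v$. Then the following asymptotic expansion holds: $$\begin{bmatrix}x(u,v)\\ y(u,v)\end{bmatrix}=\begin{bmatrix}\alpha(u)\\ \beta(u)\end{bmatrix}+\frac{(3v)^{2/3}\,\operatorname{sgn}\kappa(u)}{2\,|\kappa(u)|^{1/3}\sqrt{\alpha'(u)^2+\beta'(u)^2}}\begin{bmatrix}-\beta'(u)\\ \alpha'(u)\end{bmatrix}+o(v^{2/3})$$ as $a\le u\le b$ and $v$ is positive and approaches $0$.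
   Context: Here $n$ is a real-valued, strictly positive, conveniently smooth function on the Euclidean plane (the refractive index). The initial curve $x=\alpha(t)$, $y=\beta(t)$, $a\le t\le b$, is a smooth enough plane curve whose parameter $t$ is a travel time, i.e. $n(\alpha(t),\beta(t))\sqrt{\alpha'(t)^2+\beta'(t)^2}=1$. The function $\kappa$ on $[a,b]$ is defined along the initial curve by $\kappa\cdot(\text{velocity})^2=\text{Euclidean curvature}-\langle\text{unit normal},\nabla\log n\rangle$, that is, $$\kappa(t)\,\bigl(\alpha'(t)^2+\beta'(t)^2\bigr)=\frac{\alpha'(t)\beta''(t)-\alpha''(t)\beta'(t)}{(\alpha'(t)^2+\beta'(t)^2)^{3/2}}-\Bigl\langle (\alpha'(t)^2+\beta'(t)^2)^{-1/2}\begin{bmatrix}-\beta'(t)\\ \alpha'(t)\end{bmatrix},\ \nabla\log n(\alpha(t),\beta(t))\Bigr\rangle.$$ It is assumed that $\kappa$ vanishes nowhere. The functions $x,y$ are defined either in the half-strip $a<u<b$, $0<v<\infty$, or in an appropriate bounded subset of it, and take the stated initial values on $v=0$. Subscripts denote partial derivatives; $f=f(u,v)$ is the real function determined by $x$, $y$ and $\kappa=\kappa(u)$ through the last two relations of the system.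
   Formalization: Smooth dependence on u is taken to mean that x, y and their first two u-derivatives are jointly continuous in (u,v) up to and including v = 0; smoothness in u for each v separately would not tie the initial values to the solution, and the expansion could fail. *)

theory Defs
  imports "HOL-Analysis.Analysis" "HOL-Library.Landau_Symbols"
begin

text \<open>The Euclidean plane is the type \<open>real \<times> real\<close>, whose norm and inner product are the
  Euclidean ones.\<close>

definition grad :: "('a::real_inner \<Rightarrow> real) \<Rightarrow> 'a \<Rightarrow> 'a" where
  "grad g p = (THE d. GDERIV g p :> d)"

text \<open>\<open>g1\<close> and \<open>g2\<close> are the first and second derivatives of \<open>g\<close>, one-sided at the endpoints.\<close>

definition C2_with :: "real \<Rightarrow> real \<Rightarrow> (real \<Rightarrow> real) \<Rightarrow> (real \<Rightarrow> real) \<Rightarrow> (real \<Rightarrow> real) \<Rightarrow> bool" where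
  "C2_with a b g g1 g2 \<longleftrightarrow>
     (\<forall>t\<in>{a..b}. (g has_real_derivative g1 t) (at t within {a..b}) \<and>
                 (g1 has_real_derivative g2 t) (at t within {a..b})) \<and>
     continuous_on {a..b} g2"

text \<open>Smooth dependence on the first variable \<open>u\<close> in \<open>{a..b}\<close> for every small nonnegative value
  of the second variable \<open>v\<close>: \<open>gu\<close> and \<open>guu\<close> are the first and second partial
  derivatives of \<open>g\<close> in \<open>u\<close>, and \<open>g\<close>, \<open>gu\<close>, \<open>guu\<close> are jointly continuous, the line \<open>v = 0\<close>
  included.  No differentiability in \<open>v\<close> is required.\<close>

definition C2_in_u_with ::
  "real \<Rightarrow> real \<Rightarrow> real \<Rightarrow> (real \<Rightarrow> real \<Rightarrow> real) \<Rightarrow> (real \<Rightarrow> real \<Rightarrow> real) \<Rightarrow> (real \<Rightarrow> real \<Rightarrow> real) \<Rightarrow> bool" where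
  "C2_in_u_with a b \<delta> g gu guu \<longleftrightarrow>
     (\<forall>u\<in>{a..b}. \<forall>v\<in>{0..<\<delta>}.
        ((\<lambda>s. g s v) has_real_derivative gu u v) (at u within {a..b}) \<and>
        ((\<lambda>s. gu s v) has_real_derivative guu u v) (at u within {a..b})) \<and>
     continuous_on ({a..b} \<times> {0..<\<delta>}) (\<lambda>(u, v). g u v) \<and>
     continuous_on ({a..b} \<times> {0..<\<delta>}) (\<lambda>(u, v). gu u v) \<and>
     continuous_on ({a..b} \<times> {0..<\<delta>}) (\<lambda>(u, v). guu u v)"

end

theory Submission
  imports Defs
begin

text \<open>
  Write \<open>z = (x, y)\<close>, let \<open>J\<close> be the rotation by a right angle, and put
  \<open>g = 1 - n\<^sup>2 |z\<^sub>u|\<^sup>2\<close>, so that \<open>f\<^sup>2 = g\<close> for \<open>v > 0\<close> and, because \<open>u\<close> is a travel time on the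
  initial curve, \<open>g = 0\<close> on \<open>v = 0\<close>.  The system \<open>z\<^sub>v = J z\<^sub>u / f\<close> is thus singular on the initial
  line, and everything depends on the rate at which \<open>f\<close> tends to \<open>0\<close>.

  Differentiate \<open>g\<close> in \<open>v\<close>.  The mixed derivative \<open>z\<^sub>u\<^sub>v = (J z\<^sub>u / f)\<^sub>u\<close> contains \<open>f\<^sub>u\<close> only with the
  factor \<open>J z\<^sub>u\<close>, and this is orthogonal to \<open>z\<^sub>u\<close>; so \<open>f\<^sub>u\<close> cancels and \<open>f\<^sup>2 f\<^sub>v = H\<close> remains, where
  \<open>H = n\<^sup>2 (x\<^sub>u y\<^sub>u\<^sub>u - x\<^sub>u\<^sub>u y\<^sub>u) - n \<langle>\<nabla>n, J z\<^sub>u\<rangle> |z\<^sub>u|\<^sup>2\<close> contains \<open>u\<close>-derivatives of \<open>z\<close> only and is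
  continuous up to \<open>v = 0\<close>.  The mean value theorem for \<open>f\<^sup>3\<close> gives \<open>f(u,v)\<^sup>3 = 3 v H(u,\<xi>)\<close> with
  \<open>0 < \<xi> < v\<close> (lemma \<open>cube_law\<close>).  On the initial curve \<open>H = \<kappa> |z'|\<^sup>3\<close>, which is where the
  definition of \<open>\<kappa>\<close> enters.

  Therefore \<open>z\<^sub>v = v\<^bsup>-1/3\<^esup> w\<close> with \<open>w = J z\<^sub>u(u,v) / (3 H(u,\<xi>))\<^bsup>1/3\<^esup>\<close>.  As \<open>v\<close> tends to \<open>0\<close> this \<open>w\<close>
  converges, uniformly in \<open>u\<close> by compactness, to \<open>w\<^sub>0 = J z' / ((3 \<kappa>)\<^bsup>1/3\<^esup> |z'|)\<close>, and integration in
  \<open>v\<close> gives \<open>z - z(u,0) = (3/2) v\<^bsup>2/3\<^esup> w\<^sub>0 + o(v\<^bsup>2/3\<^esup>)\<close> (lemma \<open>uniform_asymptotics\<close>); this is the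
  assertion.

  Two points need care.  The unknowns are not assumed to have mixed derivatives, so the existence of
  \<open>z\<^sub>u\<^sub>v\<close> has to be derived (lemma \<open>mixed_partial_derivative\<close>).  And the differential
  system holds in the open strip only; the endpoints \<open>u = a\<close> and \<open>u = b\<close> are reached at the very end,
  because the final estimate is between functions continuous in \<open>u\<close>.
\<close>

section \<open>Gradients\<close>

lemma GDERIV_unique:
  assumes "GDERIV g p :> d" "GDERIV g p :> e"
  shows "d = e"
proof -
  have "(\<lambda>h. h \<bullet> d) = (\<lambda>h. h \<bullet> e)"
    using assms unfolding gderiv_def by (rule has_derivative_unique)
  then have "(d - e) \<bullet> d = (d - e) \<bullet> e" by metis
  then show ?thesis by (metis inner_diff_right inner_eq_zero_iff right_minus_eq)
qed

text \<open>The gradient is a definite description, which denotes the derivative only once existence (by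
  expanding the derivative in an orthonormal basis) and uniqueness are known.\<close>

lemma differentiable_imp_GDERIV_grad:
  fixes g :: "'a::euclidean_space \<Rightarrow> real"
  assumes "g differentiable (at p)"
  shows "GDERIV g p :> grad g p"
proof -
  obtain g' where g': "(g has_derivative g') (at p)"
    using assms by (auto simp: differentiable_def)
  interpret g': bounded_linear g' using g' by (rule has_derivative_bounded_linear)
  have "g' h = h \<bullet> (\<Sum>i\<in>Basis. g' i *\<^sub>R i)" for h
  proof -
    have "g' h = g' (\<Sum>i\<in>Basis. (h \<bullet> i) *\<^sub>R i)" by (simp add: euclidean_representation)
    also have "\<dots> = (\<Sum>i\<in>Basis. (h \<bullet> i) * g' i)" by (simp add: g'.sum g'.scaleR)
    finally show ?thesis by (simp add: inner_sum_right mult.commute)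
  qed
  then have ex: "GDERIV g p :> (\<Sum>i\<in>Basis. g' i *\<^sub>R i)"
    using g' unfolding gderiv_def by (metis (no_types, lifting) ext)
  show ?thesis
    unfolding grad_def by (rule theI, rule ex) (rule GDERIV_unique[OF _ ex])
qed

lemma grad_eqI:
  fixes g :: "'a::euclidean_space \<Rightarrow> real"
  assumes "GDERIV g p :> d"
  shows "grad g p = d"
proof -
  have "GDERIV g p :> grad g p"
    by (rule differentiable_imp_GDERIV_grad)
       (use assms in \<open>auto simp: gderiv_def differentiable_def\<close>)
  then show ?thesis using assms by (rule GDERIV_unique)
qed

lemma grad_ln:
  fixes g :: "'a::euclidean_space \<Rightarrow> real"
  assumes "g differentiable (at p)" "g p > 0"
  shows "grad (\<lambda>q. ln (g q)) p = (1 / g p) *\<^sub>R grad g p"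
  by (intro grad_eqI GDERIV_DERIV_compose differentiable_imp_GDERIV_grad assms DERIV_ln_divide)

lemma has_real_derivative_along_plane_curve:
  fixes g :: "real \<times> real \<Rightarrow> real"
  assumes "g differentiable (at (X t, Y t))"
    and X: "(X has_real_derivative X') (at t)" and Y: "(Y has_real_derivative Y') (at t)"
  shows "((\<lambda>s. g (X s, Y s)) has_real_derivative grad g (X t, Y t) \<bullet> (X', Y')) (at t)"
proof -
  have g: "(g has_derivative (\<lambda>h. h \<bullet> grad g (X t, Y t))) (at (X t, Y t))"
    using differentiable_imp_GDERIV_grad[OF assms(1)] by (simp add: gderiv_def)
  have "((\<lambda>s. (X s, Y s)) has_derivative (\<lambda>h. (X' * h, Y' * h))) (at t)"
    using X Y unfolding has_field_derivative_def by (rule has_derivative_Pair)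
  from has_derivative_compose[OF this g] show ?thesis
    unfolding has_field_derivative_def
    by (rule has_derivative_eq_rhs) (auto simp: algebra_simps fun_eq_iff inner_prod_def)
qed

section \<open>Differentiability inherited through squares and mixed derivatives\<close>

text \<open>With its sign fixed, \<open>f\<close> is a constant multiple of a square root of \<open>g\<close>, and \<open>g\<close> is positive
  where \<open>f\<close> has a nonzero sign; hence \<open>f\<close> inherits differentiability from \<open>g\<close>.  In the strip this
  is applied in each of the two variables.\<close>

lemma signed_sqrt_derivative:
  fixes f g :: "real \<Rightarrow> real"
  assumes sq: "\<forall>\<^sub>F s in nhds t. (f s)\<^sup>2 = g s \<and> sgn (f s) = \<sigma>"
    and "\<sigma> \<noteq> 0" and g: "(g has_real_derivative g') (at t)"
  shows "(f has_real_derivative g' / (2 * f t)) (at t)"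
proof -
  have eq: "\<forall>\<^sub>F s in nhds t. f s = \<sigma> * sqrt (g s)"
    using sq by eventually_elim (metis mult_sgn_abs real_sqrt_abs)
  have t: "(f t)\<^sup>2 = g t" "sgn (f t) = \<sigma>" "f t = \<sigma> * sqrt (g t)"
    using eventually_nhds_x_imp_x[OF sq] eventually_nhds_x_imp_x[OF eq] by auto
  then have "f t \<noteq> 0" using \<open>\<sigma> \<noteq> 0\<close> by (metis sgn_zero)
  then have "g t > 0" using t(1) by (metis zero_less_power2)
  have "\<sigma> * \<sigma> = 1" using t(2) \<open>\<sigma> \<noteq> 0\<close> by (auto simp: sgn_real_def split: if_splits)
  have "((\<lambda>s. \<sigma> * sqrt (g s)) has_real_derivative \<sigma> * (g' * (inverse (sqrt (g t)) / 2))) (at t)"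
    using g \<open>g t > 0\<close> by (auto intro!: derivative_eq_intros)
  moreover have "\<sigma> * (g' * (inverse (sqrt (g t)) / 2)) = g' / (2 * f t)"
    unfolding t(3) using \<open>\<sigma> \<noteq> 0\<close> \<open>\<sigma> * \<sigma> = 1\<close> \<open>g t > 0\<close>
    by (simp add: field_simps)
  ultimately show ?thesis
    by (simp only: DERIV_cong_ev[OF refl eq refl])
qed

text \<open>One mixed derivative yields the other: \<open>h\<close> is the \<open>v\<close>-integral of \<open>hv\<close>, and differentiating
  under the integral sign shows that increments of \<open>hu\<close> in \<open>v\<close> are integrals of the continuous
  function \<open>hvu\<close>.\<close>

lemma mixed_partial_derivative:
  fixes h hu hv hvu :: "real \<Rightarrow> real \<Rightarrow> real"
  assumes u: "u \<in> {a<..<b}" and v: "v \<in> {c<..<d}"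
    and hu: "\<And>u v. u \<in> {a<..<b} \<Longrightarrow> v \<in> {c<..<d} \<Longrightarrow> ((\<lambda>s. h s v) has_real_derivative hu u v) (at u)"
    and hv: "\<And>u v. u \<in> {a<..<b} \<Longrightarrow> v \<in> {c<..<d} \<Longrightarrow> ((\<lambda>s. h u s) has_real_derivative hv u v) (at v)"
    and hvu: "\<And>u v. u \<in> {a<..<b} \<Longrightarrow> v \<in> {c<..<d} \<Longrightarrow> ((\<lambda>s. hv s v) has_real_derivative hvu u v) (at u)"
    and cont: "continuous_on ({a<..<b} \<times> {c<..<d}) (\<lambda>(u, v). hvu u v)"
  shows "((\<lambda>s. hu u s) has_real_derivative hvu u v) (at v)"
proof -
  obtain p where p: "c < p" "p < v" using v dense by auto
  obtain q where q: "v < q" "q < d" using v dense by auto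
  have FTC: "((\<lambda>t. hv s t) has_integral h s w - h s p) {p..w}"
    if "s \<in> {a<..<b}" "w \<in> {p..q}" for s w
  proof (rule fundamental_theorem_of_calculus)
    fix t assume "t \<in> {p..w}"
    then have "((\<lambda>t. h s t) has_real_derivative hv s t) (at t)"
      using that p q v by (intro hv) auto
    then show "((\<lambda>t. h s t) has_vector_derivative hv s t) (at t within {p..w})"
      unfolding has_real_derivative_iff_has_vector_derivative
      by (rule has_vector_derivative_at_within)
  qed (use that in auto)
  have increment: "hu u w - hu u p = integral {p..w} (hvu u)" if w: "w \<in> {p..q}" for w
  proof -
    have "((\<lambda>s. integral (cbox p w) (\<lambda>t. hv s t)) has_real_derivative integral (cbox p w) (hvu u))
            (at u within {a<..<b})"
    proof (rule leibniz_rule_field_derivative)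
      show "continuous_on ({a<..<b} \<times> cbox p w) (\<lambda>(s, t). hvu s t)"
        by (rule continuous_on_subset[OF cont]) (use p q w in auto)
      show "hv s integrable_on cbox p w" if "s \<in> {a<..<b}" for s
        using FTC[OF that w] by (auto intro: has_integral_integrable)
      show "((\<lambda>s. hv s t) has_real_derivative hvu s t) (at s within {a<..<b})"
        if "s \<in> {a<..<b}" "t \<in> cbox p w" for s t
        by (rule has_field_derivative_at_within, rule hvu) (use that p q w in auto)
    qed (use u in auto)
    then have 1: "((\<lambda>s. integral (cbox p w) (\<lambda>t. hv s t)) has_real_derivative integral (cbox p w) (hvu u)) (at u)"
      by (simp only: at_within_open[OF u open_greaterThanLessThan])
    have "\<forall>\<^sub>F s in nhds u. s \<in> {a<..<b}"
      using u by (intro eventually_nhds_in_open) auto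
    then have "\<forall>\<^sub>F s in nhds u. integral (cbox p w) (\<lambda>t. hv s t) = h s w - h s p"
      by eventually_elim (use w in \<open>auto intro!: integral_unique FTC\<close>)
    from iffD1[OF DERIV_cong_ev[OF refl this refl] 1]
    have "((\<lambda>s. h s w - h s p) has_real_derivative integral {p..w} (hvu u)) (at u)"
      by (simp only: cbox_interval)
    moreover have "((\<lambda>s. h s w - h s p) has_real_derivative hu u w - hu u p) (at u)"
      by (intro DERIV_diff hu) (use u p q w in auto)
    ultimately show ?thesis by (rule DERIV_unique[symmetric])
  qed
  have "continuous_on {p..q} (hvu u)"
  proof -
    have "continuous_on {p..q} (\<lambda>t. case (u, t) of (s, r) \<Rightarrow> hvu s r)"
      by (rule continuous_on_compose2[OF cont], intro continuous_intros) (use u p q in auto)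
    then show ?thesis by (simp cong: continuous_on_cong)
  qed
  then have "((\<lambda>w. integral {p..w} (hvu u)) has_real_derivative hvu u v) (at v within {p..q})"
    by (rule integral_has_real_derivative) (use p q in auto)
  then have "((\<lambda>w. hu u p + integral {p..w} (hvu u)) has_real_derivative 0 + hvu u v) (at v within {p..q})"
    by (rule DERIV_add[OF DERIV_const])
  then have "((\<lambda>w. hu u w) has_real_derivative 0 + hvu u v) (at v within {p..q})"
    by (rule has_field_derivative_transform_within[where d=1])
       (use p q in \<open>auto simp flip: increment\<close>)
  then show ?thesis using p q by (simp add: at_within_Icc_at)
qed

section \<open>Uniformity and power asymptotics\<close>

text \<open>This is uniform continuity on the compact product.  It turns continuity up to the line
  \<open>v = 0\<close> into convergence as \<open>v\<close> tends to \<open>0\<close> that is uniform in \<open>u\<close>.\<close>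

lemma uniformly_near_slice:
  fixes F :: "'a::metric_space \<times> 'b::metric_space \<Rightarrow> 'c::metric_space"
  assumes "compact A" "compact B" "w0 \<in> B" "continuous_on (A \<times> B) F" "\<epsilon> > 0"
  obtains \<eta> where "\<eta> > 0" "\<And>u w. u \<in> A \<Longrightarrow> w \<in> B \<Longrightarrow> dist w w0 < \<eta> \<Longrightarrow> dist (F (u, w)) (F (u, w0)) < \<epsilon>"
proof -
  have "uniformly_continuous_on (A \<times> B) F"
    using assms by (intro compact_uniformly_continuous compact_Times)
  then obtain \<eta> where "\<eta> > 0" and
    \<eta>: "\<And>p q. p \<in> A \<times> B \<Longrightarrow> q \<in> A \<times> B \<Longrightarrow> dist q p < \<eta> \<Longrightarrow> dist (F q) (F p) < \<epsilon>"
    using \<open>\<epsilon> > 0\<close> unfolding uniformly_continuous_on_def by metis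
  show thesis
    by (rule that[OF \<open>\<eta> > 0\<close>], rule \<eta>) (use \<open>w0 \<in> B\<close> in \<open>auto simp: dist_Pair_Pair\<close>)
qed

lemma continuous_on_curried_compose:
  assumes "continuous_on D (\<lambda>p. G (fst p) (snd p))" "continuous_on T g" "continuous_on T h"
    and "\<And>t. t \<in> T \<Longrightarrow> (g t, h t) \<in> D"
  shows "continuous_on T (\<lambda>t. G (g t) (h t))"
  using continuous_on_compose2[OF assms(1) continuous_on_Pair[OF assms(2,3)]] assms(4) by auto

text \<open>If \<open>w\<close> were equal to \<open>w0\<close>, then \<open>z\<close> would differ from its initial value by the integral
  \<open>3/2 V\<^bsup>2/3\<^esup> w0\<close> of \<open>v\<^bsup>-1/3\<^esup> w0\<close>.  An error \<open>\<epsilon>\<close> in \<open>w\<close> enters with the same factor; the derivative is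
  unbounded at \<open>0\<close>, so the mean value inequality is used with a majorant that is merely continuous
  there.\<close>

lemma two_thirds_power_asymptotics:
  fixes z w :: "real \<Rightarrow> 'a::real_normed_vector"
  assumes "0 < V" and cont: "continuous_on {0..V} z"
    and z': "\<And>v. v \<in> {0<..<V} \<Longrightarrow> (z has_vector_derivative (v powr (-1/3)) *\<^sub>R w v) (at v)"
    and w: "\<And>v. v \<in> {0<..<V} \<Longrightarrow> norm (w v - w0) \<le> \<epsilon>"
  shows "norm (z V - z 0 - (3/2 * V powr (2/3)) *\<^sub>R w0) \<le> 3/2 * \<epsilon> * V powr (2/3)"
proof -
  have powr': "((\<lambda>v. 3/2 * v powr (2/3)) has_real_derivative v powr (-1/3)) (at v)" if "v > 0" for v :: real
    using that by (auto intro!: derivative_eq_intros)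
  have cp: "continuous_on {0..V} (\<lambda>v. 3/2 * v powr (2/3))"
    by (intro continuous_intros continuous_on_powr') auto
  have "norm ((z V - (3/2 * V powr (2/3)) *\<^sub>R w0) - (z 0 - (3/2 * 0 powr (2/3)) *\<^sub>R w0))
          \<le> \<epsilon> * (3/2 * V powr (2/3)) - \<epsilon> * (3/2 * 0 powr (2/3))"
  proof (rule differentiable_bound_general)
    show "continuous_on {0..V} (\<lambda>v. z v - (3/2 * v powr (2/3)) *\<^sub>R w0)"
      by (intro continuous_intros cont cp)
    show "continuous_on {0..V} (\<lambda>v. \<epsilon> * (3/2 * v powr (2/3)))"
      by (intro continuous_intros cp)
    fix v assume v: "0 < v" "v < V"
    show "((\<lambda>v. z v - (3/2 * v powr (2/3)) *\<^sub>R w0) has_vector_derivative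
            (v powr (-1/3)) *\<^sub>R w v - (v powr (-1/3)) *\<^sub>R w0) (at v)"
      using z'[of v] powr'[of v] v by (auto intro!: derivative_eq_intros)
    show "((\<lambda>v. \<epsilon> * (3/2 * v powr (2/3))) has_vector_derivative \<epsilon> * v powr (-1/3)) (at v)"
      using DERIV_cmult[OF powr'] v by (simp flip: has_real_derivative_iff_has_vector_derivative)
    have "norm (v powr (-1/3) *\<^sub>R (w v - w0)) \<le> v powr (-1/3) * \<epsilon>"
      using w[of v] v by (auto intro!: mult_left_mono)
    then show "norm ((v powr (-1/3)) *\<^sub>R w v - (v powr (-1/3)) *\<^sub>R w0) \<le> \<epsilon> * v powr (-1/3)"
      by (simp add: scaleR_diff_right mult.commute)
  qed (use \<open>0 < V\<close> in auto)
  then show ?thesis by (simp add: algebra_simps)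
qed

lemma cube_root_eq_sgn_powr: "root 3 k = sgn k * \<bar>k\<bar> powr (1/3)"
proof (cases "k = 0")
  case False
  then have "(\<bar>k\<bar> powr (1/3)) ^ 3 = \<bar>k\<bar>" by (simp add: powr_power)
  moreover have "sgn k ^ 3 = sgn k" by (simp add: sgn_real_def)
  ultimately have "(sgn k * \<bar>k\<bar> powr (1/3)) ^ 3 = k"
    by (simp add: power_mult_distrib sgn_mult_abs)
  then show ?thesis by (intro odd_real_root_unique) auto
qed simp

text \<open>The left-hand side is the coefficient as it stands in the expansion; the right-hand side is
  the form in which integration produces it, with \<open>k\<close> the value of \<open>\<kappa>\<close> and \<open>s\<close> the speed of the
  initial curve.\<close>

lemma expansion_coefficient:
  fixes v k s :: real
  assumes "v > 0"
  shows "(3 * v) powr (2/3) * sgn k / (2 * \<bar>k\<bar> powr (1/3) * s)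
    = (3/2 * v powr (2/3)) * (1 / root 3 (3 * (k * s ^ 3)))"
proof -
  have "(3::real) powr (2/3) * 3 powr (1/3) = 3" by (simp flip: powr_add)
  then have "(3::real) powr (2/3) = 3 / 3 powr (1/3)" by (simp add: field_simps)
  then have "(3 * v) powr (2/3) = 3 / 3 powr (1/3) * v powr (2/3)"
    using \<open>v > 0\<close> by (simp add: powr_mult)
  moreover have "root 3 (s ^ 3) = s" by (rule odd_real_root_power_cancel) simp
  moreover have "root 3 3 = (3::real) powr (1/3)" by (simp add: root_powr_inverse)
  ultimately show ?thesis
    by (cases "k > 0"; cases "k = 0") (simp_all add: real_root_mult cube_root_eq_sgn_powr[of k])
qed

section \<open>Growth of the cube of \<open>f\<close> away from the initial curve\<close>

text \<open>The locale keeps what the argument uses of the system.  The sign of \<open>f\<close> is a constant here,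
  since a continuous \<open>\<kappa>\<close> without zeros keeps its sign, and the travel time normalisation appears as
  \<open>unit_speed\<close>.\<close>

locale wave_strip =
  fixes n :: "real \<times> real \<Rightarrow> real" and a b \<delta> \<sigma> :: real
    and x xu xuu y yu yuu f :: "real \<Rightarrow> real \<Rightarrow> real"
  assumes n_diff: "\<And>p. n differentiable (at p)"
    and n_C1: "continuous_on UNIV (grad n)"
    and x_C2: "C2_in_u_with a b \<delta> x xu xuu"
    and y_C2: "C2_in_u_with a b \<delta> y yu yuu"
    and xv: "\<And>u v. u \<in> {a<..<b} \<Longrightarrow> v \<in> {0<..<\<delta>} \<Longrightarrow>
      ((\<lambda>s. x u s) has_real_derivative - yu u v / f u v) (at v)"
    and yv: "\<And>u v. u \<in> {a<..<b} \<Longrightarrow> v \<in> {0<..<\<delta>} \<Longrightarrow>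
      ((\<lambda>s. y u s) has_real_derivative xu u v / f u v) (at v)"
    and sgn_f: "\<And>u v. u \<in> {a<..<b} \<Longrightarrow> v \<in> {0<..<\<delta>} \<Longrightarrow> sgn (f u v) = \<sigma>"
    and \<sigma>_nz: "\<sigma> \<noteq> 0"
    and f_sq: "\<And>u v. u \<in> {a<..<b} \<Longrightarrow> v \<in> {0<..<\<delta>} \<Longrightarrow>
      (f u v)\<^sup>2 = 1 - (n (x u v, y u v))\<^sup>2 * ((xu u v)\<^sup>2 + (yu u v)\<^sup>2)"
    and unit_speed: "\<And>u. u \<in> {a<..<b} \<Longrightarrow>
      (n (x u 0, y u 0))\<^sup>2 * ((xu u 0)\<^sup>2 + (yu u 0)\<^sup>2) = 1"
begin

definition slack :: "real \<Rightarrow> real \<Rightarrow> real" where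
  "slack u v = 1 - (n (x u v, y u v))\<^sup>2 * ((xu u v)\<^sup>2 + (yu u v)\<^sup>2)"

text \<open>This is the function \<open>H\<close> with \<open>f\<^sup>2 f\<^sub>v = H\<close>.  Where \<open>n |z\<^sub>u| = 1\<close>, as on the initial
  curve, it is \<open>|z\<^sub>u|\<close> times the right-hand side of the equation that defines \<open>\<kappa>\<close>.\<close>

definition drive :: "real \<Rightarrow> real \<Rightarrow> real" where
  "drive u v = (n (x u v, y u v))\<^sup>2 * (xu u v * yuu u v - xuu u v * yu u v)
     - n (x u v, y u v) * (grad n (x u v, y u v) \<bullet> (- yu u v, xu u v)) * ((xu u v)\<^sup>2 + (yu u v)\<^sup>2)"

definition slack_u :: "real \<Rightarrow> real \<Rightarrow> real" where
  "slack_u u v = - (2 * n (x u v, y u v) * (grad n (x u v, y u v) \<bullet> (xu u v, yu u v)) * ((xu u v)\<^sup>2 + (yu u v)\<^sup>2)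
     + (n (x u v, y u v))\<^sup>2 * (2 * xu u v * xuu u v + 2 * yu u v * yuu u v))"

definition fu :: "real \<Rightarrow> real \<Rightarrow> real" where
  "fu u v = slack_u u v / (2 * f u v)"

text \<open>\<open>xvu\<close> and \<open>yvu\<close> are the \<open>u\<close>-derivatives of the right-hand sides \<open>- yu / f\<close> and \<open>xu / f\<close> of
  the system.\<close>

definition xvu :: "real \<Rightarrow> real \<Rightarrow> real" where
  "xvu u v = - (yuu u v * f u v - yu u v * fu u v) / (f u v)\<^sup>2"

definition yvu :: "real \<Rightarrow> real \<Rightarrow> real" where
  "yvu u v = (xuu u v * f u v - xu u v * fu u v) / (f u v)\<^sup>2"

lemma f_nz: "u \<in> {a<..<b} \<Longrightarrow> v \<in> {0<..<\<delta>} \<Longrightarrow> f u v \<noteq> 0"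
  using sgn_f \<sigma>_nz by (metis sgn_zero)

lemma f_sq_slack: "u \<in> {a<..<b} \<Longrightarrow> v \<in> {0<..<\<delta>} \<Longrightarrow> (f u v)\<^sup>2 = slack u v"
  by (simp add: f_sq slack_def)

lemma f_eq: "u \<in> {a<..<b} \<Longrightarrow> v \<in> {0<..<\<delta>} \<Longrightarrow> f u v = \<sigma> * sqrt (slack u v)"
  using f_sq_slack sgn_f by (metis mult_sgn_abs real_sqrt_abs)

lemma u_derivs:
  assumes "u \<in> {a<..<b}" "v \<in> {0<..<\<delta>}"
  shows "((\<lambda>s. x s v) has_real_derivative xu u v) (at u)"
    and "((\<lambda>s. xu s v) has_real_derivative xuu u v) (at u)"
    and "((\<lambda>s. y s v) has_real_derivative yu u v) (at u)"
    and "((\<lambda>s. yu s v) has_real_derivative yuu u v) (at u)"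
proof -
  have "at u within {a..b} = at u" using assms by (simp add: at_within_Icc_at)
  moreover have "u \<in> {a..b}" "v \<in> {0..<\<delta>}" using assms by auto
  ultimately show "((\<lambda>s. x s v) has_real_derivative xu u v) (at u)"
    "((\<lambda>s. xu s v) has_real_derivative xuu u v) (at u)"
    "((\<lambda>s. y s v) has_real_derivative yu u v) (at u)"
    "((\<lambda>s. yu s v) has_real_derivative yuu u v) (at u)"
    using x_C2 y_C2 unfolding C2_in_u_with_def by metis+
qed

lemma joint_continuity:
  assumes S: "S \<subseteq> {a..b} \<times> {0..<\<delta>}"
  shows "continuous_on S (\<lambda>p. x (fst p) (snd p))" "continuous_on S (\<lambda>p. xu (fst p) (snd p))"
    "continuous_on S (\<lambda>p. xuu (fst p) (snd p))" "continuous_on S (\<lambda>p. y (fst p) (snd p))"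
    "continuous_on S (\<lambda>p. yu (fst p) (snd p))" "continuous_on S (\<lambda>p. yuu (fst p) (snd p))"
  using x_C2 y_C2 unfolding C2_in_u_with_def split_beta
  by (auto intro: continuous_on_subset[OF _ S])

lemma medium_continuity:
  assumes S: "S \<subseteq> {a..b} \<times> {0..<\<delta>}"
  shows "continuous_on S (\<lambda>p. n (x (fst p) (snd p), y (fst p) (snd p)))"
    and "continuous_on S (\<lambda>p. grad n (x (fst p) (snd p), y (fst p) (snd p)))"
proof -
  have n: "continuous_on UNIV n"
    using n_diff by (simp add: continuous_on_eq_continuous_within differentiable_imp_continuous_within)
  have z: "continuous_on S (\<lambda>p. (x (fst p) (snd p), y (fst p) (snd p)))"
    by (intro continuous_on_Pair joint_continuity[OF S])
  show "continuous_on S (\<lambda>p. n (x (fst p) (snd p), y (fst p) (snd p)))"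
    by (rule continuous_on_compose2[OF n z]) simp
  show "continuous_on S (\<lambda>p. grad n (x (fst p) (snd p), y (fst p) (snd p)))"
    by (rule continuous_on_compose2[OF n_C1 z]) simp
qed

lemma slack_continuous: "S \<subseteq> {a..b} \<times> {0..<\<delta>} \<Longrightarrow> continuous_on S (\<lambda>p. slack (fst p) (snd p))"
  and drive_continuous: "S \<subseteq> {a..b} \<times> {0..<\<delta>} \<Longrightarrow> continuous_on S (\<lambda>p. drive (fst p) (snd p))"
  and slack_u_continuous: "S \<subseteq> {a..b} \<times> {0..<\<delta>} \<Longrightarrow> continuous_on S (\<lambda>p. slack_u (fst p) (snd p))"
  unfolding slack_def drive_def slack_u_def
  by (intro continuous_intros joint_continuity medium_continuity; assumption)+

lemma f_has_u_derivative:
  assumes u: "u \<in> {a<..<b}" and v: "v \<in> {0<..<\<delta>}"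
  shows "((\<lambda>s. f s v) has_real_derivative fu u v) (at u)"
  unfolding fu_def
proof (rule signed_sqrt_derivative[OF _ \<sigma>_nz])
  have "\<forall>\<^sub>F s in nhds u. s \<in> {a<..<b}"
    using u by (intro eventually_nhds_in_open) auto
  then show "\<forall>\<^sub>F s in nhds u. (f s v)\<^sup>2 = slack s v \<and> sgn (f s v) = \<sigma>"
    by eventually_elim (use v f_sq_slack sgn_f in blast)
  show "((\<lambda>s. slack s v) has_real_derivative slack_u u v) (at u)"
    unfolding slack_def slack_u_def
    by (rule derivative_eq_intros has_real_derivative_along_plane_curve n_diff u_derivs[OF u v] refl)+
       (simp add: algebra_simps)
qed

text \<open>The two functions \<open>xvu\<close> and \<open>yvu\<close> are continuous where \<open>f\<close> does not vanish, so the order of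
  differentiation can be exchanged.\<close>

lemma z_u_has_v_derivative:
  assumes u: "u \<in> {a<..<b}" and v: "v \<in> {0<..<\<delta>}"
  shows "((\<lambda>s. xu u s) has_real_derivative xvu u v) (at v)"
    and "((\<lambda>s. yu u s) has_real_derivative yvu u v) (at v)"
proof -
  let ?S = "{a<..<b} \<times> {0<..<\<delta>}"
  have S: "?S \<subseteq> {a..b} \<times> {0..<\<delta>}" by auto
  have f: "continuous_on ?S (\<lambda>p. f (fst p) (snd p))"
    by (subst continuous_on_cong[OF refl, where g = "\<lambda>p. \<sigma> * sqrt (slack (fst p) (snd p))"])
       (use f_eq slack_continuous[OF S] in \<open>auto intro!: continuous_intros\<close>)
  have fu: "continuous_on ?S (\<lambda>p. fu (fst p) (snd p))"
    unfolding fu_def using f_nz by (intro continuous_intros f slack_u_continuous[OF S]) auto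
  show "((\<lambda>s. xu u s) has_real_derivative xvu u v) (at v)"
  proof (rule mixed_partial_derivative[OF u v])
    show "((\<lambda>s. x s w) has_real_derivative xu t w) (at t)"
      if "t \<in> {a<..<b}" "w \<in> {0<..<\<delta>}" for t w using that by (rule u_derivs)
    show "((\<lambda>s. x t s) has_real_derivative - yu t w / f t w) (at w)"
      if "t \<in> {a<..<b}" "w \<in> {0<..<\<delta>}" for t w using that by (rule xv)
    show "((\<lambda>s. - yu s w / f s w) has_real_derivative xvu t w) (at t)"
      if "t \<in> {a<..<b}" "w \<in> {0<..<\<delta>}" for t w
      unfolding xvu_def
      by (rule derivative_eq_intros u_derivs[OF that] f_has_u_derivative[OF that] f_nz[OF that] refl)+
         (simp add: power2_eq_square)
    show "continuous_on ?S (\<lambda>(s, t). xvu s t)"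
      unfolding xvu_def split_beta using f_nz
      by (intro continuous_intros f fu joint_continuity[OF S]) auto
  qed
  show "((\<lambda>s. yu u s) has_real_derivative yvu u v) (at v)"
  proof (rule mixed_partial_derivative[OF u v])
    show "((\<lambda>s. y s w) has_real_derivative yu t w) (at t)"
      if "t \<in> {a<..<b}" "w \<in> {0<..<\<delta>}" for t w using that by (rule u_derivs)
    show "((\<lambda>s. y t s) has_real_derivative xu t w / f t w) (at w)"
      if "t \<in> {a<..<b}" "w \<in> {0<..<\<delta>}" for t w using that by (rule yv)
    show "((\<lambda>s. xu s w / f s w) has_real_derivative yvu t w) (at t)"
      if "t \<in> {a<..<b}" "w \<in> {0<..<\<delta>}" for t w
      unfolding yvu_def
      by (rule derivative_eq_intros u_derivs[OF that] f_has_u_derivative[OF that] f_nz[OF that] refl)+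
         (simp add: power2_eq_square)
    show "continuous_on ?S (\<lambda>(s, t). yvu s t)"
      unfolding yvu_def split_beta using f_nz
      by (intro continuous_intros f fu joint_continuity[OF S]) auto
  qed
qed

text \<open>Here the singular terms cancel: \<open>slack\<close> has \<open>v\<close>-derivative \<open>2 drive / f\<close>, in which \<open>f\<^sub>u\<close> no
  longer occurs.\<close>

lemma f_has_v_derivative:
  assumes u: "u \<in> {a<..<b}" and v: "v \<in> {0<..<\<delta>}"
  shows "((\<lambda>s. f u s) has_real_derivative drive u v / (f u v)\<^sup>2) (at v)"
proof -
  have "((\<lambda>s. f u s) has_real_derivative (2 * drive u v / f u v) / (2 * f u v)) (at v)"
  proof (rule signed_sqrt_derivative[OF _ \<sigma>_nz])
    have "\<forall>\<^sub>F s in nhds v. s \<in> {0<..<\<delta>}"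
      using v by (intro eventually_nhds_in_open) auto
    then show "\<forall>\<^sub>F s in nhds v. (f u s)\<^sup>2 = slack u s \<and> sgn (f u s) = \<sigma>"
      by eventually_elim (use u f_sq_slack sgn_f in blast)
    \<comment> \<open>The terms with \<open>fu\<close> form a multiple of \<open>\<langle>z\<^sub>u, J z\<^sub>u\<rangle> = 0\<close>.\<close>
    have *: "xu u v * xvu u v + yu u v * yvu u v = - (xu u v * yuu u v - xuu u v * yu u v) / f u v"
      using f_nz[OF u v] by (simp add: xvu_def yvu_def field_simps power2_eq_square)
    have **: "grad n (x u v, y u v) \<bullet> (- yu u v / f u v, xu u v / f u v)
        = (grad n (x u v, y u v) \<bullet> (- yu u v, xu u v)) / f u v"
      by (simp add: inner_prod_def field_simps add_divide_distrib diff_divide_distrib)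
    have "((\<lambda>s. slack u s) has_real_derivative
        - (2 * n (x u v, y u v) * (grad n (x u v, y u v) \<bullet> (- yu u v / f u v, xu u v / f u v))
             * ((xu u v)\<^sup>2 + (yu u v)\<^sup>2)
           + (n (x u v, y u v))\<^sup>2 * (2 * (xu u v * xvu u v + yu u v * yvu u v)))) (at v)"
      unfolding slack_def
      by (rule derivative_eq_intros has_real_derivative_along_plane_curve n_diff xv[OF u v] yv[OF u v]
            z_u_has_v_derivative[OF u v] refl)+ (simp add: algebra_simps)
    then show "((\<lambda>s. slack u s) has_real_derivative 2 * drive u v / f u v) (at v)"
      unfolding * ** drive_def
      by (rule DERIV_cong) (simp add: algebra_simps add_divide_distrib diff_divide_distrib)
  qed
  then show ?thesis by (simp add: power2_eq_square)
qed

text \<open>By the previous lemma \<open>f\<^sup>3\<close> has \<open>v\<close>-derivative \<open>3 drive\<close>, and it tends to \<open>0\<close> with \<open>v\<close>.\<close>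

lemma cube_law:
  assumes u: "u \<in> {a<..<b}" and v: "v \<in> {0<..<\<delta>}"
  obtains \<xi> where "\<xi> \<in> {0<..<v}" "(f u v) ^ 3 = v * (3 * drive u \<xi>)"
proof -
  \<comment> \<open>Nothing is known about \<open>f u 0\<close>; \<open>G\<close> is the continuous extension of \<open>f\<^sup>3\<close> to \<open>v = 0\<close>.\<close>
  define G where "G s = \<sigma> * sqrt (slack u s) ^ 3" for s
  have "\<sigma> ^ 3 = \<sigma>"
    using sgn_f[OF u v] by (auto simp: sgn_real_def split: if_splits)
  then have G: "G s = (f u s) ^ 3" if "s \<in> {0<..<\<delta>}" for s
    using f_eq[OF u that] by (simp add: G_def power_mult_distrib)
  have "continuous_on {0..v} (\<lambda>s. slack u s)"
    by (rule continuous_on_curried_compose[OF slack_continuous[OF order_refl]])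
       (use u v in \<open>auto intro!: continuous_intros\<close>)
  then have cont: "continuous_on {0..v} G"
    unfolding G_def by (auto intro!: continuous_intros)
  have deriv: "(G has_derivative (\<lambda>h. 3 * drive u s * h)) (at s)" if "0 < s" "s < v" for s
  proof -
    have s: "s \<in> {0<..<\<delta>}" using that v by auto
    have "((\<lambda>s. f u s ^ 3) has_real_derivative 3 * drive u s) (at s)"
      by (rule derivative_eq_intros f_has_v_derivative[OF u s] refl)+
         (use f_nz[OF u s] in simp)
    moreover have "\<forall>\<^sub>F s in nhds s. G s = f u s ^ 3"
      using eventually_nhds_in_open[OF open_greaterThanLessThan s]
      by eventually_elim (rule G)
    ultimately have "(G has_real_derivative 3 * drive u s) (at s)"
      using DERIV_cong_ev[OF refl _ refl, of G "\<lambda>s. f u s ^ 3" s] by blast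
    then show ?thesis by (simp add: has_field_derivative_def)
  qed
  obtain \<xi> where "0 < \<xi>" "\<xi> < v" "G v - G 0 = 3 * drive u \<xi> * (v - 0)"
    using mvt[of 0 v G "\<lambda>s h. 3 * drive u s * h"] v cont deriv by auto
  moreover have "G 0 = 0"
    using unit_speed[OF u] by (simp add: G_def slack_def)
  ultimately show thesis using that[of \<xi>] G[OF v] by (simp add: mult_ac)
qed

section \<open>Asymptotics, uniform up to the endpoints\<close>

text \<open>By the cube law \<open>1 / f = v\<^bsup>-1/3\<^esup> / (3 drive u \<xi>)\<^bsup>1/3\<^esup>\<close>, so \<open>v\<^bsup>1/3\<^esup> z\<^sub>v\<close> is the value at \<open>(u, v, \<xi>)\<close> of
  one function of three variables, continuous up to \<open>v = \<xi> = 0\<close>.  Treating the unknown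
  intermediate point \<open>\<xi>\<close> as an independent variable is what makes the convergence uniform.\<close>

lemma uniform_asymptotics:
  assumes ab: "a < b" and \<delta>: "\<delta> > 0"
    and drive0: "\<And>u. u \<in> {a..b} \<Longrightarrow> drive u 0 \<noteq> 0" and "\<epsilon> > 0"
  obtains \<eta> where "\<eta> > 0" "\<And>u v. u \<in> {a..b} \<Longrightarrow> v \<in> {0<..<\<eta>} \<Longrightarrow>
    norm ((x u v, y u v) - ((x u 0, y u 0)
      + (3/2 * v powr (2/3)) *\<^sub>R (1 / root 3 (3 * drive u 0)) *\<^sub>R (- yu u 0, xu u 0)))
    \<le> \<epsilon> * v powr (2/3)"
proof -
  \<comment> \<open>\<open>drive\<close> stays away from \<open>0\<close> on a closed strip of some height \<open>d\<close>, where its cube root can be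
    inverted.\<close>
  obtain k where k: "k > 0" "\<And>u. u \<in> {a..b} \<Longrightarrow> k \<le> \<bar>drive u 0\<bar>"
  proof -
    have "continuous_on {a..b} (\<lambda>u. drive u 0)"
      by (rule continuous_on_curried_compose[OF drive_continuous[OF order_refl]])
         (use \<delta> in \<open>auto intro!: continuous_intros\<close>)
    then have "continuous_on {a..b} (\<lambda>u. \<bar>drive u 0\<bar>)" by (auto intro!: continuous_intros)
    then obtain m where "m \<in> {a..b}" "\<And>u. u \<in> {a..b} \<Longrightarrow> \<bar>drive m 0\<bar> \<le> \<bar>drive u 0\<bar>"
      using continuous_attains_inf[of "{a..b}" "\<lambda>u. \<bar>drive u 0\<bar>"] ab by auto
    then show thesis using drive0[of m] that[of "\<bar>drive m 0\<bar>"] by auto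
  qed
  have "continuous_on ({a..b} \<times> {0..\<delta>/2}) (\<lambda>p. drive (fst p) (snd p))"
    by (rule drive_continuous) (use \<delta> in auto)
  then obtain \<eta>1 where \<eta>1: "\<eta>1 > 0"
    "\<And>u w. u \<in> {a..b} \<Longrightarrow> w \<in> {0..\<delta>/2} \<Longrightarrow> dist w 0 < \<eta>1 \<Longrightarrow> dist (drive u w) (drive u 0) < k"
    using uniformly_near_slice[of "{a..b}" "{0..\<delta>/2}" 0 _ k] k(1) \<delta>
    by (metis (no_types, lifting) atLeastAtMost_iff compact_Icc fst_conv half_gt_zero less_imp_le order_refl snd_conv)
  define d where "d = min (\<delta>/2) (\<eta>1/2)"
  have d: "d > 0" "d < \<delta>" "d \<le> \<delta>/2" "d < \<eta>1" using \<delta> \<eta>1(1) by (auto simp: d_def)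
  have drive_nz: "drive u w \<noteq> 0" if "u \<in> {a..b}" "w \<in> {0..d}" for u w
    using \<eta>1(2)[of u w] k(2)[of u] that d by (auto simp: dist_real_def)
  define F where "F p = (1 / root 3 (3 * drive (fst p) (snd (snd p)))) *\<^sub>R
      (- yu (fst p) (fst (snd p)), xu (fst p) (fst (snd p)))" for p
  have "continuous_on ({a..b} \<times> {0..d} \<times> {0..d}) F"
  proof -
    let ?T = "{a..b} \<times> {0..d} \<times> {0..d}"
    have "continuous_on ?T (\<lambda>p. drive (fst p) (snd (snd p)))"
      by (rule continuous_on_curried_compose[OF drive_continuous[OF order_refl]])
         (use d in \<open>auto intro!: continuous_intros\<close>)
    moreover have "continuous_on ?T (\<lambda>p. yu (fst p) (fst (snd p)))"
      by (rule continuous_on_curried_compose[OF joint_continuity(5)[OF order_refl]])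
         (use d in \<open>auto intro!: continuous_intros\<close>)
    moreover have "continuous_on ?T (\<lambda>p. xu (fst p) (fst (snd p)))"
      by (rule continuous_on_curried_compose[OF joint_continuity(2)[OF order_refl]])
         (use d in \<open>auto intro!: continuous_intros\<close>)
    ultimately show ?thesis
      unfolding F_def fst_conv snd_conv
      by (intro continuous_intros) (use drive_nz in auto)
  qed
  then obtain \<eta>2 where \<eta>2: "\<eta>2 > 0"
    "\<And>u p. u \<in> {a..b} \<Longrightarrow> p \<in> {0..d} \<times> {0..d} \<Longrightarrow> dist p (0, 0) < \<eta>2
       \<Longrightarrow> dist (F (u, p)) (F (u, (0, 0))) < 2/3 * \<epsilon>"
    using uniformly_near_slice[of "{a..b}" "{0..d} \<times> {0..d}" "(0, 0)" F "2/3 * \<epsilon>"] d(1) \<open>\<epsilon> > 0\<close>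
    by (auto simp: compact_Times)
  define \<eta> where "\<eta> = min d (\<eta>2/2)"
  have \<eta>: "\<eta> > 0" "\<eta> \<le> d" "2 * \<eta> \<le> \<eta>2" using d \<eta>2(1) by (auto simp: \<eta>_def)
  \<comment> \<open>The estimate for interior \<open>u\<close>, where the differential system holds.\<close>
  have inner: "norm ((x u V, y u V) - ((x u 0, y u 0)
      + (3/2 * V powr (2/3)) *\<^sub>R F (u, (0, 0)))) \<le> \<epsilon> * V powr (2/3)"
    if u: "u \<in> {a<..<b}" and V: "V \<in> {0<..<\<eta>}" for u V
  proof -
    have strip: "v \<in> {0<..<\<delta>}" if "v \<in> {0<..V}" for v using that V \<eta> d by auto
    have "\<exists>\<xi>. \<xi> \<in> {0<..<v} \<and> (f u v) ^ 3 = v * (3 * drive u \<xi>)" if "v \<in> {0<..V}" for v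
      using cube_law[OF u strip[OF that]] by metis
    then obtain \<xi> where \<xi>: "\<And>v. v \<in> {0<..V} \<Longrightarrow> \<xi> v \<in> {0<..<v}"
      "\<And>v. v \<in> {0<..V} \<Longrightarrow> (f u v) ^ 3 = v * (3 * drive u (\<xi> v))" by metis
    have "norm ((x u V, y u V) - (x u 0, y u 0) - (3/2 * V powr (2/3)) *\<^sub>R F (u, (0, 0)))
        \<le> 3/2 * (2/3 * \<epsilon>) * V powr (2/3)"
    proof (rule two_thirds_power_asymptotics[where w = "\<lambda>v. F (u, (v, \<xi> v))"])
      show "0 < V" using V by simp
      have "continuous_on {0..V} (\<lambda>v. x u v)"
        by (rule continuous_on_curried_compose[OF joint_continuity(1)[OF order_refl]])
           (use u V \<eta> d in \<open>auto intro!: continuous_intros\<close>)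
      moreover have "continuous_on {0..V} (\<lambda>v. y u v)"
        by (rule continuous_on_curried_compose[OF joint_continuity(4)[OF order_refl]])
           (use u V \<eta> d in \<open>auto intro!: continuous_intros\<close>)
      ultimately show "continuous_on {0..V} (\<lambda>v. (x u v, y u v))"
        by (simp add: continuous_on_Pair)
    next
      fix v assume "v \<in> {0<..<V}"
      then have v: "v \<in> {0<..V}" "v > 0" by auto
      have "root 3 (v * (3 * drive u (\<xi> v))) = f u v"
        by (rule odd_real_root_unique) (use \<xi>(2)[OF v(1)] in auto)
      then have "f u v = v powr (1/3) * root 3 (3 * drive u (\<xi> v))"
        using v(2) by (simp only: real_root_mult root_powr_inverse[of 3 v]) (simp add: root_powr_inverse)
      then have f: "1 / f u v = v powr (-1/3) * (1 / root 3 (3 * drive u (\<xi> v)))"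
        by (simp add: powr_minus_divide)
      have "((\<lambda>v. (x u v, y u v)) has_vector_derivative (- yu u v / f u v, xu u v / f u v)) (at v)"
        using xv[OF u strip[OF v(1)]] yv[OF u strip[OF v(1)]]
        by (intro has_vector_derivative_Pair) (auto simp: has_real_derivative_iff_has_vector_derivative)
      moreover have "(- yu u v / f u v, xu u v / f u v) = (1 / f u v) *\<^sub>R (- yu u v, xu u v)"
        by simp
      ultimately show "((\<lambda>v. (x u v, y u v)) has_vector_derivative v powr (-1/3) *\<^sub>R F (u, (v, \<xi> v))) (at v)"
        unfolding F_def by (simp only: f fst_conv snd_conv scaleR_scaleR)
      have "dist (v, \<xi> v) (0, 0) \<le> \<bar>v\<bar> + \<bar>\<xi> v\<bar>"
        by (simp add: dist_Pair_Pair dist_real_def sqrt_sum_squares_le_sum_abs)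
      also have "\<dots> < \<eta>2" using \<xi>(1)[OF v(1)] v V \<eta> by auto
      finally have "dist (F (u, (v, \<xi> v))) (F (u, (0, 0))) < 2/3 * \<epsilon>"
        by (intro \<eta>2(2)) (use \<xi>(1)[OF v(1)] v V \<eta> u in auto)
      then show "norm (F (u, (v, \<xi> v)) - F (u, (0, 0))) \<le> 2/3 * \<epsilon>"
        by (simp add: dist_norm)
    qed
    moreover have "3/2 * (2/3 * \<epsilon>) = \<epsilon>" by simp
    ultimately show ?thesis by (simp only: diff_diff_eq)
  qed
  show thesis
  proof (rule that[OF \<eta>(1)])
    fix u V assume u: "u \<in> {a..b}" and V: "V \<in> {0<..<\<eta>}"
    \<comment> \<open>Both sides are continuous in \<open>u\<close> on the closed interval, so the estimate passes to its
      endpoints.\<close>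
    have slice: "continuous_on {a..b} (\<lambda>s. G s v)"
      if "continuous_on ({a..b} \<times> {0..<\<delta>}) (\<lambda>p. G (fst p) (snd p))" "v \<in> {0..<\<delta>}"
      for G :: "real \<Rightarrow> real \<Rightarrow> real" and v
      by (rule continuous_on_curried_compose[OF that(1)]) (use that(2) in \<open>auto intro!: continuous_intros\<close>)
    have v0: "0 \<in> {0..<\<delta>}" "V \<in> {0..<\<delta>}" using V \<eta> d by auto
    note j = joint_continuity[OF order_refl]
    define E where "E s = norm ((x s V, y s V) - ((x s 0, y s 0)
      + (3/2 * V powr (2/3)) *\<^sub>R (1 / root 3 (3 * drive s 0)) *\<^sub>R (- yu s 0, xu s 0)))" for s
    have root_nz: "\<forall>s\<in>{a..b}. root 3 (3 * drive s 0) \<noteq> 0" using drive0 by simp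
    have "continuous_on {a..b} E"
      unfolding E_def
      by (intro continuous_on_norm continuous_on_diff continuous_on_add continuous_on_Pair
            continuous_on_scaleR continuous_on_divide continuous_on_real_root continuous_on_mult
            continuous_on_minus continuous_on_const root_nz
            slice[OF j(1) v0(1)] slice[OF j(1) v0(2)] slice[OF j(4) v0(1)]
            slice[OF j(4) v0(2)] slice[OF j(2) v0(1)] slice[OF j(5) v0(1)]
            slice[OF drive_continuous[OF order_refl] v0(1)])
    then have "continuous_on (closure {a<..<b}) E" using ab by simp
    then have "E u \<le> \<epsilon> * V powr (2/3)"
    proof (rule continuous_le_on_closure)
      show "u \<in> closure {a<..<b}" using u ab by simp
      show "E s \<le> \<epsilon> * V powr (2/3)" if "s \<in> {a<..<b}" for s
        using inner[OF that V] by (simp only: E_def F_def fst_conv snd_conv)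
    qed
    then show "norm ((x u V, y u V) - ((x u 0, y u 0)
      + (3/2 * V powr (2/3)) *\<^sub>R (1 / root 3 (3 * drive u 0)) *\<^sub>R (- yu u 0, xu u 0)))
      \<le> \<epsilon> * V powr (2/3)"
      by (simp only: E_def)
  qed
qed

end

section \<open>The expansion along the initial curve\<close>

theorem proposition3p1:
  fixes n :: "real \<times> real \<Rightarrow> real"
    and a b \<delta> :: real
    and \<alpha> \<alpha>1 \<alpha>2 \<beta> \<beta>1 \<beta>2 \<kappa> :: "real \<Rightarrow> real"
    and x xu xuu y yu yuu f :: "real \<Rightarrow> real \<Rightarrow> real"
    and \<Omega> :: "(real \<times> real) set"
  assumes n_pos: "\<And>p. n p > 0"
    and n_diff: "\<And>p. n differentiable (at p)"
    and n_C1: "continuous_on UNIV (grad n)"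
    and ab: "a < b"
    and alpha: "C2_with a b \<alpha> \<alpha>1 \<alpha>2"
    and beta: "C2_with a b \<beta> \<beta>1 \<beta>2"
    and travel_time: "\<And>t. t \<in> {a..b} \<Longrightarrow> n (\<alpha> t, \<beta> t) * sqrt ((\<alpha>1 t)\<^sup>2 + (\<beta>1 t)\<^sup>2) = 1"
    and kappa: "\<And>t. t \<in> {a..b} \<Longrightarrow>
      \<kappa> t * ((\<alpha>1 t)\<^sup>2 + (\<beta>1 t)\<^sup>2) =
        (\<alpha>1 t * \<beta>2 t - \<alpha>2 t * \<beta>1 t) / ((\<alpha>1 t)\<^sup>2 + (\<beta>1 t)\<^sup>2) powr (3/2)
        - (((\<alpha>1 t)\<^sup>2 + (\<beta>1 t)\<^sup>2) powr (-1/2) *\<^sub>R (- \<beta>1 t, \<alpha>1 t)) \<bullet> grad (\<lambda>p. ln (n p)) (\<alpha> t, \<beta> t)"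
    and kappa_nz: "\<And>t. t \<in> {a..b} \<Longrightarrow> \<kappa> t \<noteq> 0"
    and dom: "open \<Omega>" "\<Omega> \<subseteq> {a<..<b} \<times> {0<..}"
    and strip: "\<delta> > 0" "{a<..<b} \<times> {0<..<\<delta>} \<subseteq> \<Omega>"
    and u_deriv: "\<And>u v. (u, v) \<in> \<Omega> \<Longrightarrow>
      ((\<lambda>s. (x s v, y s v)) has_vector_derivative (xu u v, yu u v)) (at u)"
    and pde: "\<And>u v. (u, v) \<in> \<Omega> \<Longrightarrow>
      ((\<lambda>s. (x u s, y u s)) has_vector_derivative (1 / f u v) *\<^sub>R (- yu u v, xu u v)) (at v)"
    and sgn_f: "\<And>u v. (u, v) \<in> \<Omega> \<Longrightarrow> sgn (f u v) = sgn (\<kappa> u)"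
    and f_sq: "\<And>u v. (u, v) \<in> \<Omega> \<Longrightarrow>
      (f u v)\<^sup>2 = 1 - (n (x u v, y u v))\<^sup>2 * ((xu u v)\<^sup>2 + (yu u v)\<^sup>2)"
    and init: "\<And>u. u \<in> {a..b} \<Longrightarrow> x u 0 = \<alpha> u" "\<And>u. u \<in> {a..b} \<Longrightarrow> y u 0 = \<beta> u"
    and x_smooth: "C2_in_u_with a b \<delta> x xu xuu"
    and y_smooth: "C2_in_u_with a b \<delta> y yu yuu"
  shows "(\<lambda>(u, v). norm ((x u v, y u v) - ((\<alpha> u, \<beta> u)
            + ((3 * v) powr (2/3) * sgn (\<kappa> u)
                / (2 * \<bar>\<kappa> u\<bar> powr (1/3) * sqrt ((\<alpha>1 u)\<^sup>2 + (\<beta>1 u)\<^sup>2))) *\<^sub>R (- \<beta>1 u, \<alpha>1 u))))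
         \<in> o[principal {a..b} \<times>\<^sub>F at_right 0](\<lambda>(u, v). v powr (2/3))"
proof -
  have A1: "(\<alpha> has_real_derivative \<alpha>1 t) (at t within {a..b})"
    "(\<alpha>1 has_real_derivative \<alpha>2 t) (at t within {a..b})"
    and B1: "(\<beta> has_real_derivative \<beta>1 t) (at t within {a..b})"
    "(\<beta>1 has_real_derivative \<beta>2 t) (at t within {a..b})" if "t \<in> {a..b}" for t
    using alpha beta that by (auto simp: C2_with_def)
  have cont: "continuous_on {a..b} \<alpha>" "continuous_on {a..b} \<alpha>1" "continuous_on {a..b} \<alpha>2"
    "continuous_on {a..b} \<beta>" "continuous_on {a..b} \<beta>1" "continuous_on {a..b} \<beta>2"
    using DERIV_continuous_on[OF A1(1)] DERIV_continuous_on[OF A1(2)]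
      DERIV_continuous_on[OF B1(1)] DERIV_continuous_on[OF B1(2)] alpha beta
    unfolding C2_with_def by blast+
  define S where "S t = (\<alpha>1 t)\<^sup>2 + (\<beta>1 t)\<^sup>2" for t
  have n_speed: "n (\<alpha> t, \<beta> t) * sqrt (S t) = 1" if "t \<in> {a..b}" for t
    using travel_time[OF that] by (simp add: S_def)
  have S_pos: "S t > 0" if "t \<in> {a..b}" for t
    using n_speed[OF that] by (cases "S t = 0") (auto simp: S_def add_nonneg_pos less_le)
  have n_sq: "(n (\<alpha> t, \<beta> t))\<^sup>2 * S t = 1" if "t \<in> {a..b}" for t
    using n_speed[OF that] S_pos[OF that]
    by (metis less_imp_le one_power2 power_mult_distrib real_sqrt_pow2)
  have \<kappa>_eq: "\<kappa> t = ((\<alpha>1 t * \<beta>2 t - \<alpha>2 t * \<beta>1 t) / S t powr (3/2)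
      - S t powr (-1/2) * (grad n (\<alpha> t, \<beta> t) \<bullet> (- \<beta>1 t, \<alpha>1 t)) / n (\<alpha> t, \<beta> t)) / S t"
    if t: "t \<in> {a..b}" for t
  proof -
    have inner: "(r *\<^sub>R N) \<bullet> ((1 / m) *\<^sub>R g) = r * (g \<bullet> N) / m" for r m and N g :: "real \<times> real"
      by (simp add: inner_commute)
    show ?thesis
      using kappa[OF t] S_pos[OF t] unfolding S_def[symmetric] grad_ln[OF n_diff n_pos] inner
      by (metis less_irrefl nonzero_mult_div_cancel_right)
  qed
  have n_cont: "continuous_on UNIV n"
    using n_diff by (simp add: continuous_on_eq_continuous_within differentiable_imp_continuous_within)
  have curve: "continuous_on {a..b} (\<lambda>t. (\<alpha> t, \<beta> t))" by (intro continuous_on_Pair cont)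
  have \<kappa>_cont: "continuous_on {a..b} \<kappa>"
  proof (subst continuous_on_cong[OF refl \<kappa>_eq], assumption)
    have n: "continuous_on {a..b} (\<lambda>t. n (\<alpha> t, \<beta> t))"
      by (rule continuous_on_compose2[OF n_cont curve]) simp
    have g: "continuous_on {a..b} (\<lambda>t. grad n (\<alpha> t, \<beta> t))"
      by (rule continuous_on_compose2[OF n_C1 curve]) simp
    have S: "continuous_on {a..b} S" unfolding S_def by (intro continuous_intros cont)
    have nz: "S t \<noteq> 0" "n (\<alpha> t, \<beta> t) \<noteq> 0" if "t \<in> {a..b}" for t
      using S_pos[OF that] n_pos[of "(\<alpha> t, \<beta> t)"] by auto
    show "continuous_on {a..b} (\<lambda>t. ((\<alpha>1 t * \<beta>2 t - \<alpha>2 t * \<beta>1 t) / S t powr (3/2)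
      - S t powr (-1/2) * (grad n (\<alpha> t, \<beta> t) \<bullet> (- \<beta>1 t, \<alpha>1 t)) / n (\<alpha> t, \<beta> t)) / S t)"
      by (intro continuous_intros cont n g S) (use nz in auto)
  qed
  have \<kappa>_sgn: "sgn (\<kappa> t) = sgn (\<kappa> a)" if t: "t \<in> {a..b}" for t
  proof (rule ccontr)
    assume ne: "sgn (\<kappa> t) \<noteq> sgn (\<kappa> a)"
    have c: "continuous_on {a..t} \<kappa>" by (rule continuous_on_subset[OF \<kappa>_cont]) (use t in auto)
    have "\<exists>s. a \<le> s \<and> s \<le> t \<and> \<kappa> s = 0"
    proof (cases "\<kappa> a < 0")
      case True
      then show ?thesis using ne t c kappa_nz[of a] by (intro IVT') (auto simp: sgn_real_def split: if_splits)
    next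
      case False
      then show ?thesis using ne t c kappa_nz[of a] by (intro IVT2') (auto simp: sgn_real_def split: if_splits)
    qed
    then show False using kappa_nz t by force
  qed
  have u_within: "((\<lambda>s. x s v) has_real_derivative xu u v) (at u within {a..b})"
    "((\<lambda>s. xu s v) has_real_derivative xuu u v) (at u within {a..b})"
    "((\<lambda>s. y s v) has_real_derivative yu u v) (at u within {a..b})"
    "((\<lambda>s. yu s v) has_real_derivative yuu u v) (at u within {a..b})"
    if "u \<in> {a..b}" "v \<in> {0..<\<delta>}" for u v
    using x_smooth y_smooth that unfolding C2_in_u_with_def by metis+
  have unique: "d = e" if "t \<in> {a..b}" "(g has_real_derivative d) (at t within {a..b})"
    "(h has_real_derivative e) (at t within {a..b})" "\<And>s. s \<in> {a..b} \<Longrightarrow> g s = h s"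
    for g h :: "real \<Rightarrow> real" and d e t
  proof -
    have "(h has_real_derivative d) (at t within {a..b})"
      by (rule has_field_derivative_transform_within[OF that(2) zero_less_one]) (use that in auto)
    then show ?thesis using that(3) vector_derivative_unique_within_closed_interval[OF ab, of t h d e] that(1)
      by (simp add: has_real_derivative_iff_has_vector_derivative)
  qed
  have v0: "0 \<in> {0..<\<delta>}" using strip by simp
  \<comment> \<open>On \<open>v = 0\<close> the prescribed \<open>u\<close>-derivatives must be those of the initial curve, at the endpoints
    as one-sided derivatives.\<close>
  have init1: "xu u 0 = \<alpha>1 u" "yu u 0 = \<beta>1 u" if u: "u \<in> {a..b}" for u
    by (rule unique[OF u u_within(1)[OF u v0] A1(1)[OF u]], rule init, assumption)
       (rule unique[OF u u_within(3)[OF u v0] B1(1)[OF u]], rule init, assumption)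
  have init2: "xuu u 0 = \<alpha>2 u" "yuu u 0 = \<beta>2 u" if u: "u \<in> {a..b}" for u
    by (rule unique[OF u u_within(2)[OF u v0] A1(2)[OF u]], rule init1, assumption)
       (rule unique[OF u u_within(4)[OF u v0] B1(2)[OF u]], rule init1, assumption)
  have in_\<Omega>: "(u, v) \<in> \<Omega>" if "u \<in> {a<..<b}" "v \<in> {0<..<\<delta>}" for u v
    using strip that by auto
  interpret wave_strip n a b \<delta> "sgn (\<kappa> a)" x xu xuu y yu yuu f
  proof
    fix u v assume uv: "u \<in> {a<..<b}" "v \<in> {0<..<\<delta>}"
    note \<Omega> = in_\<Omega>[OF uv]
    have d: "((\<lambda>s. (x u s, y u s)) has_derivative (\<lambda>h. h *\<^sub>R (1 / f u v) *\<^sub>R (- yu u v, xu u v))) (at v)"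
      using pde[OF \<Omega>] by (simp only: has_vector_derivative_def)
    show "((\<lambda>s. x u s) has_real_derivative - yu u v / f u v) (at v)"
      using has_derivative_fst[OF d] unfolding has_field_derivative_def fst_conv snd_conv
      by (rule has_derivative_eq_rhs) (simp add: fun_eq_iff)
    show "((\<lambda>s. y u s) has_real_derivative xu u v / f u v) (at v)"
      using has_derivative_snd[OF d] unfolding has_field_derivative_def fst_conv snd_conv
      by (rule has_derivative_eq_rhs) (simp add: fun_eq_iff)
    show "sgn (f u v) = sgn (\<kappa> a)"
      using sgn_f[OF \<Omega>] \<kappa>_sgn[of u] uv by simp
    show "(f u v)\<^sup>2 = 1 - (n (x u v, y u v))\<^sup>2 * ((xu u v)\<^sup>2 + (yu u v)\<^sup>2)"
      by (rule f_sq[OF \<Omega>])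
  next
    fix u assume "u \<in> {a<..<b}"
    then have u: "u \<in> {a..b}" by simp
    show "(n (x u 0, y u 0))\<^sup>2 * ((xu u 0)\<^sup>2 + (yu u 0)\<^sup>2) = 1"
      using n_sq[OF u] by (simp only: init[OF u] init1[OF u] S_def)
  qed (use n_diff n_C1 x_smooth y_smooth kappa_nz[of a] ab in \<open>auto simp: sgn_zero_iff\<close>)
  \<comment> \<open>With \<open>q\<close> the speed of the initial curve and \<open>n = 1 / q\<close>, \<open>drive u 0\<close> becomes \<open>q\<close> times the
    right-hand side of the equation defining \<open>\<kappa> u * q\<^sup>2\<close>.\<close>
  have drive0: "drive u 0 = \<kappa> u * sqrt (S u) ^ 3" if u: "u \<in> {a..b}" for u
  proof -
    define q where "q = sqrt (S u)"
    have q: "q > 0" "S u = q\<^sup>2" using S_pos[OF u] by (auto simp: q_def)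
    have nq: "n (\<alpha> u, \<beta> u) = 1 / q"
      using n_speed[OF u] q(1) unfolding q_def[symmetric] by (simp add: field_simps)
    have S_powr: "S u powr r = q powr (2 * r)" for r
    proof -
      have "S u = q powr 2" using q by simp
      then show ?thesis by (simp only: powr_powr)
    qed
    have p: "S u powr (3/2) = q ^ 3" "S u powr (-1/2) = 1 / q"
      using q(1) unfolding S_powr by (simp_all add: powr_minus_divide)
    show ?thesis
      unfolding drive_def init[OF u] init1[OF u] init2[OF u] \<kappa>_eq[OF u]
        S_def[symmetric] p nq q_def[symmetric]
      unfolding q(2)
      using q(1) by (simp add: field_simps power2_eq_square power3_eq_cube)
  qed
  have coeff: "(3 * v) powr (2/3) * sgn (\<kappa> u) / (2 * \<bar>\<kappa> u\<bar> powr (1/3) * sqrt (S u))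
      = (3/2 * v powr (2/3)) * (1 / root 3 (3 * drive u 0))" if u: "u \<in> {a..b}" and "v > 0" for u v
    using expansion_coefficient[OF \<open>v > 0\<close>, of "\<kappa> u" "sqrt (S u)"] by (simp only: drive0[OF u])
  have drive0_nz: "drive u 0 \<noteq> 0" if "u \<in> {a..b}" for u
    using drive0[OF that] kappa_nz[OF that] S_pos[OF that] by simp
  show ?thesis
  proof (rule landau_o.smallI)
    fix c :: real assume "c > 0"
    obtain \<eta> where \<eta>: "\<eta> > 0" "\<And>u v. u \<in> {a..b} \<Longrightarrow> v \<in> {0<..<\<eta>} \<Longrightarrow>
      norm ((x u v, y u v) - ((x u 0, y u 0)
        + (3/2 * v powr (2/3)) *\<^sub>R (1 / root 3 (3 * drive u 0)) *\<^sub>R (- yu u 0, xu u 0)))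
      \<le> c * v powr (2/3)"
      using uniform_asymptotics[OF ab strip(1) drive0_nz \<open>c > 0\<close>] by blast
    have "\<forall>\<^sub>F v in at_right 0. v \<in> {0<..<\<eta>}"
      using \<eta>(1) by (rule eventually_at_right_real)
    then show "\<forall>\<^sub>F p in principal {a..b} \<times>\<^sub>F at_right 0.
        norm (case p of (u, v) \<Rightarrow> norm ((x u v, y u v) - ((\<alpha> u, \<beta> u)
            + ((3 * v) powr (2/3) * sgn (\<kappa> u)
                / (2 * \<bar>\<kappa> u\<bar> powr (1/3) * sqrt ((\<alpha>1 u)\<^sup>2 + (\<beta>1 u)\<^sup>2))) *\<^sub>R (- \<beta>1 u, \<alpha>1 u))))
        \<le> c * norm (case p of (u, v) \<Rightarrow> v powr (2/3))"
      unfolding eventually_prod_filter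
    proof (intro exI conjI allI impI)
      show "\<forall>\<^sub>F u in principal {a..b}. u \<in> {a..b}" by (simp add: eventually_principal)
      fix u v assume u: "u \<in> {a..b}" and v: "v \<in> {0<..<\<eta>}"
      then have "v > 0" by simp
      show "norm (case (u, v) of (u, v) \<Rightarrow> norm ((x u v, y u v) - ((\<alpha> u, \<beta> u)
            + ((3 * v) powr (2/3) * sgn (\<kappa> u)
                / (2 * \<bar>\<kappa> u\<bar> powr (1/3) * sqrt ((\<alpha>1 u)\<^sup>2 + (\<beta>1 u)\<^sup>2))) *\<^sub>R (- \<beta>1 u, \<alpha>1 u))))
        \<le> c * norm (case (u, v) of (u, v) \<Rightarrow> v powr (2/3))"
        using \<eta>(2)[OF u v]
        unfolding prod.case S_def[symmetric] coeff[OF u \<open>v > 0\<close>] init[OF u] init1[OF u] scaleR_scaleR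
        by simp
    qed
  qed
qed

end
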